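(* The space $\ell_{1,w}(c_0(\mathbb K))$ is a $b$-ideal that is not a $v$-ideal.
   Context: $\mathbb K=\mathbb R$ or $\mathbb C$; $c_0(\mathbb K)$ is the Banach space of scalar null sequences with the supremum norm. For a Banach space $X$, $S(X)$ is the space of all sequences in $X$ and $\ell_{1,w}(X):=\{s\in S(X):\sum_n|\langle s(n),x^*\rangle|<\infty\ \forall x^*\in X^*\}$. A vector subspace $U\subseteq S(X)$ is a $b$-ideal if $b\cdot s\in U$ for every $b\in\ell_\infty(\mathbb K)$ and $s\in U$, where $(b\cdot s)(n)=b(n)s(n)$. $U$ is a $v$-ideal if whenever $f\in S(X)$, $g\in U$ and $\|f(n)\|\le\|g(n)\|$ for all $n$, then $f\in U$. *)

theory Defs
  imports "HOL-Analysis.Analysis" "HOL-Library.Function_Algebras"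
begin

section \<open>The Banach space of scalar null sequences\<close>

text \<open>
  The scalar field is a type \<open>'k\<close> of class \<^class>\<open>real_normed_field\<close>; it is instantiated with
  \<^typ>\<open>real\<close> and \<^typ>\<open>complex\<close>.
\<close>

typedef (overloaded) 'k c0 = "{f :: nat \<Rightarrow> 'k::real_normed_field. f \<longlonglongrightarrow> 0}"
  morphisms c0_nth Abs_c0
  by (rule exI[of _ "\<lambda>_. 0"]) simp

setup_lifting type_definition_c0

lemma c0_nth_tendsto: "c0_nth f \<longlonglongrightarrow> 0"
  using c0_nth[of f] by simp

lemma c0_eqI: "(\<And>n. c0_nth f n = c0_nth g n) \<Longrightarrow> f = g"
  by (metis c0_nth_inject ext)

lemma bdd_above_norm_null_seq:
  fixes f :: "nat \<Rightarrow> 'k::real_normed_vector"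
  assumes "f \<longlonglongrightarrow> 0"
  shows "bdd_above (range (\<lambda>n. norm (f n)))"
proof -
  have "Bseq f" using assms by (intro convergent_imp_Bseq convergentI)
  then obtain K where "\<And>n. norm (f n) \<le> K" by (auto simp: Bseq_def)
  then show ?thesis by (auto intro!: bdd_aboveI[of _ K])
qed

instantiation c0 :: (real_normed_field) real_normed_vector
begin

lift_definition zero_c0 :: "'a c0" is "\<lambda>_. 0" by simp

lift_definition plus_c0 :: "'a c0 \<Rightarrow> 'a c0 \<Rightarrow> 'a c0" is "\<lambda>f g n. f n + g n"
  by (rule tendsto_add_zero)

lift_definition uminus_c0 :: "'a c0 \<Rightarrow> 'a c0" is "\<lambda>f n. - f n"
  using tendsto_minus by fastforce

lift_definition minus_c0 :: "'a c0 \<Rightarrow> 'a c0 \<Rightarrow> 'a c0" is "\<lambda>f g n. f n - g n"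
  using tendsto_diff by fastforce

lift_definition scaleR_c0 :: "real \<Rightarrow> 'a c0 \<Rightarrow> 'a c0" is "\<lambda>r f n. r *\<^sub>R f n"
  using tendsto_scaleR[OF tendsto_const] by fastforce

lift_definition norm_c0 :: "'a c0 \<Rightarrow> real" is "\<lambda>f. SUP n. norm (f n)" .

definition dist_c0 :: "'a c0 \<Rightarrow> 'a c0 \<Rightarrow> real"
  where "dist_c0 f g = norm (f - g)"

definition sgn_c0 :: "'a c0 \<Rightarrow> 'a c0"
  where "sgn_c0 f = inverse (norm f) *\<^sub>R f"

definition uniformity_c0 :: "('a c0 \<times> 'a c0) filter"
  where "uniformity_c0 = (INF e\<in>{0<..}. principal {(x, y). dist x y < e})"

definition open_c0 :: "'a c0 set \<Rightarrow> bool"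
  where "open_c0 U = (\<forall>x\<in>U. \<forall>\<^sub>F (x', y) in uniformity. x' = x \<longrightarrow> y \<in> U)"

lemma norm_c0_nth_le: "norm (c0_nth f n) \<le> norm f" for f :: "'a c0"
  by transfer (auto intro!: cSUP_upper bdd_above_norm_null_seq)

lemma norm_c0_le: "(\<And>n. norm (c0_nth f n) \<le> B) \<Longrightarrow> norm f \<le> B" for f :: "'a c0"
  by transfer (auto intro!: cSUP_least)

instance
proof
  fix x y z :: "'a c0" and a b :: real
  show "norm x = 0 \<longleftrightarrow> x = 0"
  proof
    assume "norm x = 0"
    then have "c0_nth x n = c0_nth 0 n" for n
      using norm_c0_nth_le[of x n] by (simp add: zero_c0.rep_eq)
    then show "x = 0" by (rule c0_eqI)
  qed (simp add: norm_c0.rep_eq zero_c0.rep_eq)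
  show "norm (x + y) \<le> norm x + norm y"
    by (rule norm_c0_le)
      (metis plus_c0.rep_eq norm_triangle_mono norm_c0_nth_le)
  show "norm (a *\<^sub>R x) = \<bar>a\<bar> * norm x"
  proof (rule antisym)
    show "norm (a *\<^sub>R x) \<le> \<bar>a\<bar> * norm x"
      by (rule norm_c0_le) (simp add: scaleR_c0.rep_eq mult_left_mono norm_c0_nth_le)
    show "\<bar>a\<bar> * norm x \<le> norm (a *\<^sub>R x)"
    proof (cases "a = 0")
      case True
      have "0 \<le> norm (a *\<^sub>R x)"
        using norm_c0_nth_le[of "a *\<^sub>R x" 0] norm_ge_zero order_trans by blast
      with True show ?thesis by simp
    next
      case False
      have "norm x \<le> norm (a *\<^sub>R x) / \<bar>a\<bar>"
      proof (rule norm_c0_le)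
        fix n
        show "norm (c0_nth x n) \<le> norm (a *\<^sub>R x) / \<bar>a\<bar>"
          using norm_c0_nth_le[of "a *\<^sub>R x" n] False
          by (simp add: scaleR_c0.rep_eq field_simps)
      qed
      with False show ?thesis by (simp add: field_simps)
    qed
  qed
qed (simp_all add: dist_c0_def sgn_c0_def uniformity_c0_def open_c0_def c0_nth_inject[symmetric]
      plus_c0.rep_eq minus_c0.rep_eq uminus_c0.rep_eq zero_c0.rep_eq scaleR_c0.rep_eq
      fun_eq_iff algebra_simps)

end

instance c0 :: ("{real_normed_field, banach}") banach
proof
  fix X :: "nat \<Rightarrow> 'a c0"
  assume X: "Cauchy X"
  have le: "norm (c0_nth (X m) n - c0_nth (X k) n) \<le> norm (X m - X k)" for m k n
    using norm_c0_nth_le[of "X m - X k" n] by (simp add: minus_c0.rep_eq)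
  have "Cauchy (\<lambda>m. c0_nth (X m) n)" for n
  proof (rule CauchyI)
    fix e :: real assume "e > 0"
    then obtain M where "\<forall>m\<ge>M. \<forall>k\<ge>M. norm (X m - X k) < e"
      using CauchyD[OF X] by blast
    then show "\<exists>M. \<forall>m\<ge>M. \<forall>k\<ge>M. norm (c0_nth (X m) n - c0_nth (X k) n) < e"
      using le le_less_trans by blast
  qed
  then have "\<exists>l. (\<lambda>m. c0_nth (X m) n) \<longlonglongrightarrow> l" for n
    by (simp add: Cauchy_convergent_iff convergent_def)
  then obtain L where L: "\<And>n. (\<lambda>m. c0_nth (X m) n) \<longlonglongrightarrow> L n" by metis
  have unif: "\<exists>M. \<forall>m\<ge>M. \<forall>n. norm (c0_nth (X m) n - L n) \<le> e" if e: "e > 0" for e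
  proof -
    obtain M where M: "\<forall>m\<ge>M. \<forall>k\<ge>M. norm (X m - X k) < e"
      using CauchyD[OF X e] by blast
    have "norm (c0_nth (X m) n - L n) \<le> e" if m: "m \<ge> M" for m n
    proof (rule LIMSEQ_le_const2)
      show "(\<lambda>k. norm (c0_nth (X m) n - c0_nth (X k) n)) \<longlonglongrightarrow> norm (c0_nth (X m) n - L n)"
        by (intro tendsto_intros L)
      show "\<exists>N. \<forall>k\<ge>N. norm (c0_nth (X m) n - c0_nth (X k) n) \<le> e"
        using M m le by (meson less_imp_le order_trans)
    qed
    then show ?thesis by blast
  qed
  have L0: "L \<longlonglongrightarrow> 0"
  proof (rule LIMSEQ_I)
    fix e :: real assume e: "e > 0"
    from unif[of "e/2"] e obtain m where m: "\<And>n. norm (c0_nth (X m) n - L n) \<le> e/2"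
      by fastforce
    from LIMSEQ_D[OF c0_nth_tendsto[of "X m"], of "e/2"] e
    obtain N where N: "\<forall>n\<ge>N. norm (c0_nth (X m) n) < e/2" by auto
    have "norm (L n) < e" if "n \<ge> N" for n
    proof -
      have "norm (L n) \<le> norm (c0_nth (X m) n) + norm (c0_nth (X m) n - L n)"
        by (metis add.commute norm_minus_commute norm_triangle_sub)
      also have "\<dots> < e" using N m[of n] that by force
      finally show ?thesis .
    qed
    then show "\<exists>N. \<forall>n\<ge>N. norm (L n - 0) < e" by auto
  qed
  have nth_L: "c0_nth (Abs_c0 L) = L" using L0 by (simp add: Abs_c0_inverse)
  have "X \<longlonglongrightarrow> Abs_c0 L"
  proof (rule LIMSEQ_I)
    fix e :: real assume e: "e > 0"
    from unif[of "e/2"] e obtain M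
      where M: "\<forall>m\<ge>M. \<forall>n. norm (c0_nth (X m) n - L n) \<le> e/2" by auto
    have "norm (X m - Abs_c0 L) \<le> e/2" if "m \<ge> M" for m
      by (rule norm_c0_le) (use M that in \<open>simp add: minus_c0.rep_eq nth_L\<close>)
    then show "\<exists>M. \<forall>m\<ge>M. norm (X m - Abs_c0 L) < e" using e by force
  qed
  then show "convergent X" by (rule convergentI)
qed

lift_definition c0_scale :: "'k::real_normed_field \<Rightarrow> 'k c0 \<Rightarrow> 'k c0" is "\<lambda>c f n. c * f n"
  by (rule tendsto_mult_right_zero)

lemma vector_space_c0_scale: "vector_space c0_scale"
  by standard (simp_all add: c0_nth_inject[symmetric] c0_scale.rep_eq plus_c0.rep_eq
      fun_eq_iff algebra_simps)

lemma scaleR_c0_eq: "r *\<^sub>R f = c0_scale (of_real r) f"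
  by (simp add: c0_nth_inject[symmetric] c0_scale.rep_eq scaleR_c0.rep_eq scaleR_conv_of_real)

lemma norm_c0_scale: "norm (c0_scale c f) = norm c * norm f"
proof (rule antisym)
  show le: "norm (c0_scale c f) \<le> norm c * norm f" for c and f :: "'a c0"
    by (rule norm_c0_le) (simp add: c0_scale.rep_eq norm_mult mult_left_mono norm_c0_nth_le)
  show "norm c * norm f \<le> norm (c0_scale c f)"
  proof (cases "c = 0")
    case False
    have "c0_scale (inverse c) (c0_scale c f) = f"
      using False by (simp add: c0_nth_inject[symmetric] c0_scale.rep_eq fun_eq_iff)
    then have "norm f \<le> norm (inverse c) * norm (c0_scale c f)" by (metis le)
    with False show ?thesis by (simp add: norm_inverse norm_divide field_simps)
  qed simp
qed


section \<open>Spaces of vector-valued sequences\<close>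

text \<open>
  A normed space over the field \<open>'k\<close> is given by a type \<open>'x\<close> of class
  \<^class>\<open>real_normed_vector\<close> together with its scalar multiplication \<open>scl :: 'k \<Rightarrow> 'x \<Rightarrow> 'x\<close>, which
  is meant to extend the real one. \<open>S(X)\<close> is the type \<open>nat \<Rightarrow> 'x\<close>, with pointwise operations.
\<close>

definition dual_space ::
    "('k::real_normed_field \<Rightarrow> 'x::real_normed_vector \<Rightarrow> 'x) \<Rightarrow> ('x \<Rightarrow> 'k) set"
  where "dual_space scl = {\<phi>. Vector_Spaces.linear scl (*) \<phi> \<and> bounded_linear \<phi>}"

definition weakly_summable_seqs ::
    "('k::real_normed_field \<Rightarrow> 'x::real_normed_vector \<Rightarrow> 'x) \<Rightarrow> (nat \<Rightarrow> 'x) set"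
  where "weakly_summable_seqs scl =
    {s. \<forall>\<phi>\<in>dual_space scl. summable (\<lambda>n. norm (\<phi> (s n)))}"

definition seq_subspace ::
    "('k::real_normed_field \<Rightarrow> 'x::real_normed_vector \<Rightarrow> 'x) \<Rightarrow> (nat \<Rightarrow> 'x) set \<Rightarrow> bool"
  where "seq_subspace scl U \<longleftrightarrow> module.subspace (\<lambda>c s n. scl c (s n)) U"

definition b_ideal ::
    "('k::real_normed_field \<Rightarrow> 'x::real_normed_vector \<Rightarrow> 'x) \<Rightarrow> (nat \<Rightarrow> 'x) set \<Rightarrow> bool"
  where "b_ideal scl U \<longleftrightarrow> seq_subspace scl U \<and>
    (\<forall>b :: nat \<Rightarrow> 'k. \<forall>s\<in>U. Bseq b \<longrightarrow> (\<lambda>n. scl (b n) (s n)) \<in> U)"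

definition v_ideal ::
    "('k::real_normed_field \<Rightarrow> 'x::real_normed_vector \<Rightarrow> 'x) \<Rightarrow> (nat \<Rightarrow> 'x) set \<Rightarrow> bool"
  where "v_ideal scl U \<longleftrightarrow> seq_subspace scl U \<and>
    (\<forall>f. \<forall>g\<in>U. (\<forall>n. norm (f n) \<le> norm (g n)) \<longrightarrow> f \<in> U)"

lemma seq_subspace_iff:
  assumes "vector_space scl"
  shows "seq_subspace scl U \<longleftrightarrow>
    (\<lambda>_. 0) \<in> U \<and> (\<forall>s\<in>U. \<forall>t\<in>U. (\<lambda>n. s n + t n) \<in> U) \<and>
    (\<forall>c. \<forall>s\<in>U. (\<lambda>n. scl c (s n)) \<in> U)"
proof -
  interpret vector_space scl by fact
  interpret seq: module "\<lambda>c s n. scl c (s n)"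
    by standard (simp_all add: fun_eq_iff scale_right_distrib scale_left_distrib)
  show ?thesis
    unfolding seq_subspace_def seq.subspace_def by (simp add: zero_fun_def plus_fun_def)
qed

end

theory Submission
  imports Defs
begin

text \<open>
  Weak summability is inherited by bounded scalar multiples because functionals are homogeneous.
  The unit vectors \<open>e\<^sub>n\<close> of \<open>c\<^sub>0\<close> form a weakly summable sequence: choosing signs \<open>u\<^sub>n\<close> with
  \<open>u\<^sub>n \<phi>(e\<^sub>n) = \<bar>\<phi>(e\<^sub>n)\<bar>\<close>, the sum of the \<open>u\<^sub>n e\<^sub>n\<close> over a finite set has norm at most one. The constant
  sequence \<open>e\<^sub>0\<close> has the same norms, but is not weakly summable.
\<close>

lemma weakly_summable_seqs_mult_Bseq:
  assumes s: "s \<in> weakly_summable_seqs scl" and b: "Bseq b"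
  shows "(\<lambda>n. scl (b n) (s n)) \<in> weakly_summable_seqs scl"
  unfolding weakly_summable_seqs_def
proof (intro CollectI ballI)
  fix \<phi> assume \<phi>: "\<phi> \<in> dual_space scl"
  \<comment> \<open>\<open>bounded_linear\<close> knows only real scalars; pulling out
    \<open>b n\<close> from the field needs the other half of \<open>dual_space\<close>.\<close>
  then interpret \<phi>: Vector_Spaces.linear scl "(*)" \<phi>
    by (simp add: dual_space_def)
  obtain K where K: "\<And>n. norm (b n) \<le> K"
    using b by (auto simp: Bseq_def)
  have "summable (\<lambda>n. K * norm (\<phi> (s n)))"
    using s \<phi> by (intro summable_mult) (simp add: weakly_summable_seqs_def)
  then show "summable (\<lambda>n. norm (\<phi> (scl (b n) (s n))))"
    by (rule summable_comparison_test'[where N = 0])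
      (simp add: \<phi>.scale norm_mult K mult_right_mono)
qed

lemma weakly_summable_seqs_add:
  assumes "s \<in> weakly_summable_seqs scl" and "t \<in> weakly_summable_seqs scl"
  shows "(\<lambda>n. s n + t n) \<in> weakly_summable_seqs scl"
  unfolding weakly_summable_seqs_def
proof (intro CollectI ballI)
  fix \<phi> assume \<phi>: "\<phi> \<in> dual_space scl"
  then interpret \<phi>: bounded_linear \<phi>
    by (simp add: dual_space_def)
  have "summable (\<lambda>n. norm (\<phi> (s n)) + norm (\<phi> (t n)))"
    using assms \<phi> by (intro summable_add) (simp_all add: weakly_summable_seqs_def)
  then show "summable (\<lambda>n. norm (\<phi> (s n + t n)))"
    by (rule summable_comparison_test'[where N = 0]) (simp add: \<phi>.add norm_triangle_ineq)
qed

lemma zero_in_weakly_summable_seqs: "(\<lambda>_. 0) \<in> weakly_summable_seqs scl"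
  by (simp add: weakly_summable_seqs_def dual_space_def linear_0 bounded_linear.linear)

text \<open>The scalar multiples demanded of a subspace are the case of a constant multiplier
  \<open>b\<close>.\<close>

lemma b_ideal_weakly_summable_seqs:
  assumes "vector_space scl"
  shows "b_ideal scl (weakly_summable_seqs scl)"
  using assms
  by (auto simp: b_ideal_def seq_subspace_iff zero_in_weakly_summable_seqs
      intro: weakly_summable_seqs_add weakly_summable_seqs_mult_Bseq)

lift_definition c0_unit :: "nat \<Rightarrow> 'k::real_normed_field c0"
  is "\<lambda>m n. if n = m then 1 else 0"
proof (rule tendsto_eventually)
  fix m show "\<forall>\<^sub>F n in sequentially. (if n = m then 1 else 0) = (0 :: 'k)"
    using eventually_gt_at_top[of m] by (rule eventually_mono) simp
qed

lemma norm_c0_unit: "norm (c0_unit m :: 'k::real_normed_field c0) = 1"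
proof (rule antisym)
  show "norm (c0_unit m :: 'k c0) \<le> 1"
    by (rule norm_c0_le) (simp add: c0_unit.rep_eq)
  show "1 \<le> norm (c0_unit m :: 'k c0)"
    using norm_c0_nth_le[of "c0_unit m :: 'k c0" m] by (simp add: c0_unit.rep_eq)
qed

lemma c0_nth_sum: "c0_nth (sum f A) n = (\<Sum>i\<in>A. c0_nth (f i) n)"
  by (induction A rule: infinite_finite_induct) (simp_all add: zero_c0.rep_eq plus_c0.rep_eq)

text \<open>The supremum norm bounds each coordinate, with constant 1. These functionals serve to
  detect that a constant sequence is not weakly summable.\<close>

lemma c0_nth_in_dual_space:
  "(\<lambda>x :: 'k::real_normed_field c0. c0_nth x n) \<in> dual_space c0_scale"
proof -
  interpret c0: vector_space "c0_scale :: 'k \<Rightarrow> _" by (rule vector_space_c0_scale)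
  interpret field: vector_space "(*) :: 'k \<Rightarrow> 'k \<Rightarrow> 'k"
    by standard (simp_all add: algebra_simps)
  have "Vector_Spaces.linear c0_scale (*) (\<lambda>x :: 'k c0. c0_nth x n)"
    by unfold_locales (simp_all add: plus_c0.rep_eq c0_scale.rep_eq)
  moreover have "bounded_linear (\<lambda>x :: 'k c0. c0_nth x n)"
    by (rule bounded_linear_intro[where K = 1])
      (simp_all add: plus_c0.rep_eq scaleR_c0.rep_eq norm_c0_nth_le)
  ultimately show ?thesis by (simp add: dual_space_def)
qed

lemma c0_unit_weakly_summable:
  "(c0_unit :: nat \<Rightarrow> 'k::real_normed_field c0) \<in> weakly_summable_seqs c0_scale"
  unfolding weakly_summable_seqs_def
proof (intro CollectI ballI)
  fix \<phi> :: "'k c0 \<Rightarrow> 'k" assume \<phi>: "\<phi> \<in> dual_space c0_scale"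
  then interpret \<phi>: Vector_Spaces.linear c0_scale "(*)" \<phi>
    by (simp add: dual_space_def)
  have "bounded_linear \<phi>"
    using \<phi> by (simp add: dual_space_def)
  then obtain K where K: "\<And>x. norm (\<phi> x) \<le> norm x * K" and "0 \<le> K"
    using bounded_linear.nonneg_bounded by blast
  define u where "u n = of_real (norm (\<phi> (c0_unit n))) / \<phi> (c0_unit n)" for n
    \<comment> \<open>equal to 0 where \<open>\<phi>\<close> vanishes\<close>
  show "summable (\<lambda>n. norm (\<phi> (c0_unit n)))"
  proof (rule bounded_imp_summable)
    fix N
    let ?x = "\<Sum>n\<le>N. c0_scale (u n) (c0_unit n)"
    \<comment> \<open>The unit vectors have disjoint supports, so coordinate \<open>k\<close> sees
      at most one summand, and each \<open>u k\<close> has norm 0 or 1.\<close>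
    have "c0_nth ?x k = (if k \<le> N then u k else 0)" for k
      by (simp add: c0_nth_sum c0_scale.rep_eq c0_unit.rep_eq if_distrib cong: if_cong)
    then have x: "norm ?x \<le> 1"
      by (intro norm_c0_le) (simp add: u_def norm_divide)
    have "\<phi> ?x = of_real (\<Sum>n\<le>N. norm (\<phi> (c0_unit n)))"
      by (auto simp: \<phi>.sum \<phi>.scale u_def intro!: sum.cong)
    \<comment> \<open>The norm is taken while \<open>of_real\<close> still stands outside the sum;
      it gives the absolute value of a nonnegative real.\<close>
    then have "(\<Sum>n\<le>N. norm (\<phi> (c0_unit n))) = norm (\<phi> ?x)"
      by (simp only: norm_of_real) (simp add: sum_nonneg)
    also have "\<dots> \<le> K"
      using K[of ?x] mult_right_mono[OF x \<open>0 \<le> K\<close>] by simp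
    finally show "(\<Sum>n\<le>N. norm (\<phi> (c0_unit n))) \<le> K" .
  qed simp
qed

text \<open>The coordinate functional at \<open>m\<close> takes the value 1 on every term, and a
  constant series of ones diverges.\<close>

lemma const_c0_unit_not_weakly_summable:
  "(\<lambda>_. c0_unit m :: 'k::real_normed_field c0) \<notin> weakly_summable_seqs c0_scale"
proof
  assume "(\<lambda>_. c0_unit m :: 'k c0) \<in> weakly_summable_seqs c0_scale"
  then have "summable (\<lambda>_::nat. norm (c0_nth (c0_unit m :: 'k c0) m))"
    using c0_nth_in_dual_space[of m] unfolding weakly_summable_seqs_def
    by (simp only: mem_Collect_eq) (drule (1) bspec)
  then show False
    by (simp add: c0_unit.rep_eq summable_const_iff)
qed

lemma not_v_ideal_weakly_summable_seqs_c0: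
  "\<not> v_ideal c0_scale (weakly_summable_seqs c0_scale :: (nat \<Rightarrow> 'k::real_normed_field c0) set)"
proof
  assume "v_ideal c0_scale (weakly_summable_seqs c0_scale :: (nat \<Rightarrow> 'k c0) set)"
  then have "f \<in> weakly_summable_seqs c0_scale"
    if "g \<in> weakly_summable_seqs c0_scale" and "\<And>n. norm (f n) \<le> norm (g n)"
    for f g :: "nat \<Rightarrow> 'k c0"
    using that unfolding v_ideal_def by blast
  \<comment> \<open>All unit vectors have norm 1, so \<open>c0_unit\<close> dominates the constant
    sequence at \<open>c0_unit 0\<close>, with equality in every term.\<close>
  from this[OF c0_unit_weakly_summable]
  have "(\<lambda>_. c0_unit 0 :: 'k c0) \<in> weakly_summable_seqs c0_scale"
    by (simp add: norm_c0_unit)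
  then show False
    by (simp add: const_c0_unit_not_weakly_summable)
qed

theorem corollary11p2:
  shows "(b_ideal c0_scale (weakly_summable_seqs c0_scale :: (nat \<Rightarrow> real c0) set) \<and>
          \<not> v_ideal c0_scale (weakly_summable_seqs c0_scale :: (nat \<Rightarrow> real c0) set)) \<and>
         (b_ideal c0_scale (weakly_summable_seqs c0_scale :: (nat \<Rightarrow> complex c0) set) \<and>
          \<not> v_ideal c0_scale (weakly_summable_seqs c0_scale :: (nat \<Rightarrow> complex c0) set))"
  by (intro conjI b_ideal_weakly_summable_seqs vector_space_c0_scale
      not_v_ideal_weakly_summable_seqs_c0)

end
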